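(* Let $\Gamma$ and $\Gamma'$ be finite simple graphs with at least three vertices, let $f:V(\Gamma)\to V(\Gamma')$ be a bijection, and for each $v\in V(\Gamma)$ let $\phi_v:\Gamma-v\to\Gamma'-f(v)$ be a graph isomorphism. Let $\widetilde{\Gamma}$ be the associated directed graph of $(\Gamma,\Gamma',f,\{\phi_v\}_{v\in V(\Gamma)})$. Then for all $v\in V(\widetilde{\Gamma})$, the number of normal-arrows arising from $v$ and the number of dashed-arrows arising from $v$ are equal in $\widetilde{\Gamma}$.
   Context: $\Gamma-v$ denotes the full (induced) subgraph of $\Gamma$ on $V(\Gamma)\setminus\{v\}$; $E(\Gamma)$ is the edge set and $[u,w]$ denotes an edge joining $u$ and $w$. The associated directed graph $\widetilde{\Gamma}=\widetilde{\Gamma}(\Gamma,\Gamma',f,\{\phi_v\}_{v\in V(\Gamma)})$ has vertex set $V(\widetilde{\Gamma})=V(\Gamma)$ and two kinds of arrows. There is a normal-arrow from $v_1$ to $v_2$, written $v_1\longrightarrow v_2$, if and only if $v_2\ne v_1$, $[v_1,v_2]\notin E(\Gamma)$ and $[f(v_1),\phi_{v_1}(v_2)]\in E(\Gamma')$. There is a dashed-arrow from $v_1$ to $v_2$, written $v_1\dashrightarrow v_2$, if and only if $v_2\neq v_1$, $[f(v_1),f(v_2)]\notin E(\Gamma')$ and $[v_1,\phi_{v_1}^{-1}(f(v_2))]\in E(\Gamma)$. (The condition $v_2\ne v_1$ is needed for $\phi_{v_1}(v_2)$ and $\phi_{v_1}^{-1}(f(v_2))$ to be defined.) An arrow "arises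 from $v$" if $v$ is its starting vertex. *)

theory Defs
  imports "Graph_Theory.Digraph_Component"
begin

text \<open>
  Finite simple graphs are instances of \<^locale>\<open>graph\<close>: finite, loop-free, symmetric digraphs
  without parallel arcs. An undirected edge \<open>[u, w]\<close> is a pair of opposite arcs, so that
  \<open>[u, w]\<close> is an edge of \<open>G\<close> iff \<open>u \<rightarrow>\<^bsub>G\<^esub> w\<close>.
\<close>

definition vertex_deleted :: "('a,'b) pre_digraph \<Rightarrow> 'a \<Rightarrow> ('a,'b) pre_digraph" where
  "vertex_deleted G v = G \<restriction> (verts G - {v})"

definition graph_isomorphism ::
    "('a,'b) pre_digraph \<Rightarrow> ('c,'d) pre_digraph \<Rightarrow> ('a \<Rightarrow> 'c) \<Rightarrow> bool" where
  "graph_isomorphism G H \<phi> \<longleftrightarrow>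
     bij_betw \<phi> (verts G) (verts H) \<and>
     (\<forall>u\<in>verts G. \<forall>w\<in>verts G. u \<rightarrow>\<^bsub>G\<^esub> w \<longleftrightarrow> \<phi> u \<rightarrow>\<^bsub>H\<^esub> \<phi> w)"

text \<open>
  In the next definitions \<open>\<phi> v\<close> is total, but only its restriction to \<open>verts G - {v}\<close>
  is meaningful; the arrow conditions never use it elsewhere.
\<close>

definition normal_arrow ::
    "('a,'b) pre_digraph \<Rightarrow> ('c,'d) pre_digraph \<Rightarrow> ('a \<Rightarrow> 'c) \<Rightarrow> ('a \<Rightarrow> 'a \<Rightarrow> 'c) \<Rightarrow> 'a \<Rightarrow> 'a \<Rightarrow> bool" where
  "normal_arrow G G' f \<phi> v1 v2 \<longleftrightarrow>
     v2 \<noteq> v1 \<and> \<not> v1 \<rightarrow>\<^bsub>G\<^esub> v2 \<and> f v1 \<rightarrow>\<^bsub>G'\<^esub> \<phi> v1 v2"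

definition dashed_arrow ::
    "('a,'b) pre_digraph \<Rightarrow> ('c,'d) pre_digraph \<Rightarrow> ('a \<Rightarrow> 'c) \<Rightarrow> ('a \<Rightarrow> 'a \<Rightarrow> 'c) \<Rightarrow> 'a \<Rightarrow> 'a \<Rightarrow> bool" where
  "dashed_arrow G G' f \<phi> v1 v2 \<longleftrightarrow>
     v2 \<noteq> v1 \<and> \<not> f v1 \<rightarrow>\<^bsub>G'\<^esub> f v2 \<and>
     v1 \<rightarrow>\<^bsub>G\<^esub> inv_into (verts G - {v1}) (\<phi> v1) (f v2)"

datatype arrow_kind = Normal | Dashed

text \<open>
  A normal-arrow and a dashed-arrow may join the same ordered pair of vertices, so an arc records
  its kind together with its start and its end.
\<close>

definition associated_digraph ::
    "('a,'b) pre_digraph \<Rightarrow> ('c,'d) pre_digraph \<Rightarrow> ('a \<Rightarrow> 'c) \<Rightarrow> ('a \<Rightarrow> 'a \<Rightarrow> 'c) \<Rightarrow>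
     ('a, arrow_kind \<times> 'a \<times> 'a) pre_digraph" where
  "associated_digraph G G' f \<phi> =
     \<lparr> verts = verts G,
       arcs = {(Normal, v1, v2) | v1 v2. v1 \<in> verts G \<and> v2 \<in> verts G \<and> normal_arrow G G' f \<phi> v1 v2}
            \<union> {(Dashed, v1, v2) | v1 v2. v1 \<in> verts G \<and> v2 \<in> verts G \<and> dashed_arrow G G' f \<phi> v1 v2},
       tail = (\<lambda>(k, v1, v2). v1),
       head = (\<lambda>(k, v1, v2). v2) \<rparr>"

definition arrows_from ::
    "('a, arrow_kind \<times> 'a \<times> 'a) pre_digraph \<Rightarrow> arrow_kind \<Rightarrow> 'a \<Rightarrow> (arrow_kind \<times> 'a \<times> 'a) set" where
  "arrows_from D k v = {e \<in> out_arcs D v. fst e = k}"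

lemma fin_digraph_associated_digraph:
  assumes "finite (verts G)"
  shows "fin_digraph (associated_digraph G G' f \<phi>)"
proof
  have "arcs (associated_digraph G G' f \<phi>) \<subseteq> {Normal, Dashed} \<times> verts G \<times> verts G"
    by (auto simp: associated_digraph_def)
  then show "finite (arcs (associated_digraph G G' f \<phi>))"
    by (rule finite_subset) (simp add: assms)
qed (auto simp: associated_digraph_def assms)

end

theory Submission
  imports Defs
begin

text \<open>
  Kelly's double counting: each edge survives in all but two of the vertex-deleted subgraphs, so the
  edge numbers of these subgraphs sum to \<open>(n - 2) |E|\<close>. As \<open>n \<ge> 3\<close>, the graphs \<open>\<Gamma>\<close> and \<open>\<Gamma>'\<close> have
  equally many edges; comparing with \<open>\<Gamma> - v \<cong> \<Gamma>' - f(v)\<close>, the vertices \<open>v\<close> and \<open>f(v)\<close> have the same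
  degree. With \<open>A\<close> the neighbourhood of \<open>v\<close> and \<open>B\<close> the preimage under \<open>\<phi>\<^sub>v\<close> of the neighbourhood
  of \<open>f(v)\<close>, the normal-arrows from \<open>v\<close> correspond to \<open>B - A\<close> and the dashed-arrows to \<open>A - B\<close>.
\<close>

text \<open>Double counting of the incidences between pairs in \<open>R\<close> and vertices that
  are not an end of them: the ends of a pair are distinct by irreflexivity, so each pair survives
  \<open>card V - 2\<close> deletions. The subtraction truncates only when \<open>R\<close> is
  empty. For symmetric \<open>R\<close> an edge is two ordered pairs, which doubles both sides
  alike.\<close>

lemma sum_card_vertex_deleted_rel:
  assumes "finite V" "R \<subseteq> V \<times> V" "irrefl R"
  shows "(\<Sum>v\<in>V. card (R \<inter> (V - {v}) \<times> (V - {v}))) = (card V - 2) * card R"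
proof -
  have "finite R" using assms(1,2) by (meson finite_SigmaI finite_subset)
  have "card {v\<in>V. fst p \<noteq> v \<and> snd p \<noteq> v} = card V - 2" if "p \<in> R" for p
  proof -
    obtain u w where p: "p = (u, w)" by (cases p)
    with that assms(2,3) have "u \<in> V" "w \<in> V" "u \<noteq> w"
      by (auto simp: irrefl_def)
    moreover from this p have "{v\<in>V. fst p \<noteq> v \<and> snd p \<noteq> v} = V - {u, w}" by auto
    ultimately show ?thesis by (simp add: p card_Diff_subset)
  qed
  then have "(\<Sum>v\<in>V. card {p\<in>R. fst p \<noteq> v \<and> snd p \<noteq> v}) = (card V - 2) * card R"
    by (intro sum_multicount) (use assms(1) \<open>finite R\<close> in auto)
  moreover have "{p\<in>R. fst p \<noteq> v \<and> snd p \<noteq> v} = R \<inter> (V - {v}) \<times> (V - {v})" for v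
    using assms(2) by auto
  ultimately show ?thesis by simp
qed

text \<open>The pairs lost on deleting \<open>v\<close> are those leaving \<open>v\<close> and those
  entering it. By symmetry both families are indexed by the same neighbourhood, and by irreflexivity
  they are disjoint; hence the factor 2.\<close>

lemma card_rel_eq_card_vertex_deleted_plus_degree:
  assumes "finite V" "R \<subseteq> V \<times> V" "irrefl R" "sym R"
  shows "card R = card (R \<inter> (V - {v}) \<times> (V - {v})) + 2 * card (R `` {v})"
proof -
  let ?S = "R \<inter> (V - {v}) \<times> (V - {v})" and ?N = "R `` {v}"
  have "finite R" using assms(1,2) by (meson finite_SigmaI finite_subset)
  then have fin: "finite ?S" "finite ?N" by (auto simp: finite_Image)
  have "R = ?S \<union> ({v} \<times> ?N \<union> ?N \<times> {v})"
    using assms(2,4) by (auto dest: symD)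
  then have "card R = card (?S \<union> ({v} \<times> ?N \<union> ?N \<times> {v}))" by simp
  also have "\<dots> = card ?S + card ({v} \<times> ?N \<union> ?N \<times> {v})"
    using fin by (intro card_Un_disjoint) auto
  also have "card ({v} \<times> ?N \<union> ?N \<times> {v}) = card ({v} \<times> ?N) + card (?N \<times> {v})"
    using fin assms(3) by (intro card_Un_disjoint) (auto simp: irrefl_def)
  finally show ?thesis by (simp add: card_cartesian_product)
qed

lemma verts_vertex_deleted: "verts (vertex_deleted G v) = verts G - {v}"
  by (simp add: vertex_deleted_def)

lemma arcs_ends_vertex_deleted:
  "arcs_ends (vertex_deleted G v) = arcs_ends G \<inter> (verts G - {v}) \<times> (verts G - {v})"
  by (auto simp: vertex_deleted_def arcs_ends_def arc_to_ends_def)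

lemma arcs_ends_subset_verts:
  assumes "wf_digraph G"
  shows "arcs_ends G \<subseteq> verts G \<times> verts G"
  using assms by (auto simp: arcs_ends_def arc_to_ends_def wf_digraph_def)

lemma graph_irrefl_arcs_ends:
  assumes "graph G"
  shows "irrefl (arcs_ends G)"
proof -
  interpret graph G by fact
  show ?thesis using adj_not_same by (auto simp: irrefl_def)
qed

lemma card_arcs_ends_graph_isomorphism:
  assumes "graph_isomorphism G H \<phi>"
    and "arcs_ends G \<subseteq> verts G \<times> verts G" "arcs_ends H \<subseteq> verts H \<times> verts H"
  shows "card (arcs_ends G) = card (arcs_ends H)"
proof -
  have bij: "bij_betw \<phi> (verts G) (verts H)"
    using assms(1) by (simp add: graph_isomorphism_def)
  have iso: "(u, w) \<in> arcs_ends G \<longleftrightarrow> (\<phi> u, \<phi> w) \<in> arcs_ends H"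
    if "u \<in> verts G" "w \<in> verts G" for u w
    using assms(1) that by (auto simp: graph_isomorphism_def)
  have "map_prod \<phi> \<phi> ` arcs_ends G = arcs_ends H"
  proof (intro equalityI subsetI)
    fix p assume "p \<in> map_prod \<phi> \<phi> ` arcs_ends G"
    then show "p \<in> arcs_ends H" using iso assms(2) by auto
  next
    fix p assume p: "p \<in> arcs_ends H"
    then have "p \<in> (\<phi> ` verts G) \<times> (\<phi> ` verts G)"
      using assms(3) bij by (auto simp: bij_betw_def)
    then obtain u w where "p = (\<phi> u, \<phi> w)" "u \<in> verts G" "w \<in> verts G" by auto
    then show "p \<in> map_prod \<phi> \<phi> ` arcs_ends G" using p iso by force
  qed
  moreover have "inj_on (map_prod \<phi> \<phi>) (arcs_ends G)"
    using map_prod_inj_on[of \<phi> "verts G" \<phi> "verts G"] bij assms(2)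
    by (auto simp: bij_betw_def intro: inj_on_subset)
  ultimately show ?thesis by (metis card_image)
qed

lemma hypomorphic_graphs_equal_degree:
  assumes G: "graph G" and H: "graph H"
    and n: "card (verts G) \<ge> 3"
    and f: "bij_betw f (verts G) (verts H)"
    and iso: "\<And>v. v \<in> verts G \<Longrightarrow>
      graph_isomorphism (vertex_deleted G v) (vertex_deleted H (f v)) (\<phi> v)"
    and v: "v \<in> verts G"
  shows "card (arcs_ends G `` {v}) = card (arcs_ends H `` {f v})"
proof -
  interpret G: graph G by fact
  interpret H: graph H by fact
  let ?e = "\<lambda>K. card (arcs_ends K)"
  have del: "?e (vertex_deleted G u) = ?e (vertex_deleted H (f u))" if "u \<in> verts G" for u
    by (rule card_arcs_ends_graph_isomorphism[OF iso[OF that]])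
      (auto simp: arcs_ends_vertex_deleted verts_vertex_deleted)
  \<comment> \<open>Proved for arbitrary vertex and arc types, since it is applied to both
    \<open>G\<close> and \<open>H\<close>, whose types may differ.\<close>
  have kelly: "(\<Sum>u\<in>verts K. ?e (vertex_deleted K u)) = (card (verts K) - 2) * ?e K"
    if "graph K" for K :: "('x, 'y) pre_digraph"
  proof -
    interpret K: graph K by fact
    show ?thesis
      using sum_card_vertex_deleted_rel[OF _ arcs_ends_subset_verts[OF K.wf_digraph_axioms]]
      by (simp add: arcs_ends_vertex_deleted graph_irrefl_arcs_ends[OF that])
  qed
  have "(card (verts G) - 2) * ?e G = (\<Sum>u\<in>verts G. ?e (vertex_deleted G u))"
    by (simp add: kelly[OF G])
  also have "\<dots> = (\<Sum>u\<in>verts G. ?e (vertex_deleted H (f u)))"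
    by (simp add: del)
  also have "\<dots> = (\<Sum>u\<in>verts H. ?e (vertex_deleted H u))"
    by (rule sum.reindex_bij_betw[OF f])
  also have "\<dots> = (card (verts G) - 2) * ?e H"
    by (simp add: kelly[OF H] bij_betw_same_card[OF f])
  \<comment> \<open>With at least three vertices the common factor \<open>card (verts G) - 2\<close>
    is positive and cancels.\<close>
  finally have "?e G = ?e H" using n by simp
  moreover have "?e G = ?e (vertex_deleted G v) + 2 * card (arcs_ends G `` {v})"
    unfolding arcs_ends_vertex_deleted
    by (intro card_rel_eq_card_vertex_deleted_plus_degree G.finite_verts
        arcs_ends_subset_verts G.wf_digraph_axioms graph_irrefl_arcs_ends G G.sym_arcs[unfolded symmetric_def])
  moreover have "?e H = ?e (vertex_deleted H (f v)) + 2 * card (arcs_ends H `` {f v})"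
    unfolding arcs_ends_vertex_deleted
    by (intro card_rel_eq_card_vertex_deleted_plus_degree H.finite_verts
        arcs_ends_subset_verts H.wf_digraph_axioms graph_irrefl_arcs_ends H H.sym_arcs[unfolded symmetric_def])
  ultimately show ?thesis using del[OF v] by simp
qed

text \<open>Once kind and start are fixed, an arrow is determined by its end, so counting arrows
  reduces to counting end vertices.\<close>

lemma arrows_from_associated_digraph:
  assumes "v \<in> verts G"
  shows "arrows_from (associated_digraph G G' f \<phi>) Normal v =
      (\<lambda>w. (Normal, v, w)) ` {w \<in> verts G. normal_arrow G G' f \<phi> v w}"
    and "arrows_from (associated_digraph G G' f \<phi>) Dashed v =
      (\<lambda>w. (Dashed, v, w)) ` {w \<in> verts G. dashed_arrow G G' f \<phi> v w}"
  using assms by (auto simp: arrows_from_def associated_digraph_def out_arcs_def)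

theorem proposition3p2:
  fixes G :: "('a,'b) pre_digraph" and G' :: "('c,'d) pre_digraph"
    and f :: "'a \<Rightarrow> 'c" and \<phi> :: "'a \<Rightarrow> 'a \<Rightarrow> 'c"
  assumes "graph G" and "graph G'"
    and "card (verts G) \<ge> 3" and "card (verts G') \<ge> 3"
    and "bij_betw f (verts G) (verts G')"
    and "\<And>v. v \<in> verts G \<Longrightarrow>
           graph_isomorphism (vertex_deleted G v) (vertex_deleted G' (f v)) (\<phi> v)"
  shows "\<forall>v\<in>verts (associated_digraph G G' f \<phi>).
           card (arrows_from (associated_digraph G G' f \<phi>) Normal v) =
           card (arrows_from (associated_digraph G G' f \<phi>) Dashed v)"
proof
  fix v assume "v \<in> verts (associated_digraph G G' f \<phi>)"
  then have v: "v \<in> verts G" by (simp add: associated_digraph_def)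
  interpret G: graph G by fact
  interpret G': graph G' by fact
  let ?V = "verts G - {v}" and ?V' = "verts G' - {f v}"
  let ?g = "inv_into ?V (\<phi> v)"
  define A where "A = arcs_ends G `` {v}"
  define B' where "B' = arcs_ends G' `` {f v}"
  define B where "B = ?g ` B'"
  have bij: "bij_betw (\<phi> v) ?V ?V'"
    using assms(6)[OF v] by (simp add: graph_isomorphism_def verts_vertex_deleted)
  then have bij_g: "bij_betw ?g ?V' ?V" by (rule bij_betw_inv_into)
  have "bij_betw f {v} {f v}" by simp
  then have bij_f: "bij_betw f ?V ?V'"
    using v bij_betwE[OF assms(5)] by (intro bij_betw_DiffI[OF assms(5)]) simp_all
  have A: "A \<subseteq> ?V"
    using arcs_ends_subset_verts[OF G.wf_digraph_axioms] graph_irrefl_arcs_ends[OF assms(1)]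
    by (auto simp: A_def irrefl_def)
  have B': "B' \<subseteq> ?V'"
    using arcs_ends_subset_verts[OF G'.wf_digraph_axioms] graph_irrefl_arcs_ends[OF assms(2)]
    by (auto simp: B'_def irrefl_def)
  have B: "B \<subseteq> ?V"
    using bij_betw_imp_surj_on[OF bij_g] B' by (auto simp: B_def)
  have fin: "finite A" "finite B"
    using A B by (auto intro: finite_subset)
  have mem_B: "?g y \<in> B \<longleftrightarrow> y \<in> B'" if "y \<in> ?V'" for y
    using inj_on_image_mem_iff[OF bij_betw_imp_inj_on[OF bij_g] that B'] by (simp add: B_def)
  have "card A = card B'"
    unfolding A_def B'_def by (rule hypomorphic_graphs_equal_degree[OF assms(1-3,5,6) v])
  also have "\<dots> = card B"
    using inj_on_subset[OF bij_betw_imp_inj_on[OF bij_g] B'] by (simp add: B_def card_image)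
  finally have card_AB: "card A = card B" .

  \<comment> \<open>This is \<open>mem_B\<close> at \<open>\<phi> v w\<close>, which
    \<open>?g\<close> sends back to \<open>w\<close>.\<close>
  have "w \<in> B \<longleftrightarrow> \<phi> v w \<in> B'" if "w \<in> ?V" for w
    using mem_B[OF bij_betwE[OF bij, rule_format, OF that]]
      bij_betw_inv_into_left[OF bij that] by simp
  then have normal: "{w \<in> verts G. normal_arrow G G' f \<phi> v w} = B - A"
    using B by (auto simp: normal_arrow_def A_def B'_def)
  \<comment> \<open>The dashed condition on \<open>w\<close> tests \<open>?g (f w)\<close> rather
    than \<open>w\<close>. So the ends of dashed-arrows form not \<open>A - B\<close> itself but its
    preimage under the permutation \<open>?g \<circ> f\<close> of \<open>?V\<close>, which has the
    same size.\<close>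
  have bij_gf: "bij_betw (?g \<circ> f) ?V ?V" by (rule bij_betw_trans[OF bij_f bij_g])
  have dashed: "{w \<in> verts G. dashed_arrow G G' f \<phi> v w} = {w \<in> ?V. (?g \<circ> f) w \<in> A - B}"
    using mem_B bij_betwE[OF bij_f] by (auto simp: dashed_arrow_def A_def B'_def)
  have "(?g \<circ> f) ` {w \<in> ?V. (?g \<circ> f) w \<in> A - B} = (?g \<circ> f) ` ?V \<inter> (A - B)"
    by blast
  \<comment> \<open>Surjectivity of the permutation onto \<open>?V\<close>, which contains
    \<open>A\<close>, ensures that no element of \<open>A - B\<close> is missed.\<close>
  also have "\<dots> = A - B"
    using A bij_betw_imp_surj_on[OF bij_gf] by (simp only:) blast
  finally have "bij_betw (?g \<circ> f) {w \<in> ?V. (?g \<circ> f) w \<in> A - B} (A - B)"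
    by (intro bij_betw_subset[OF bij_gf]) auto
  then have "card {w \<in> verts G. dashed_arrow G G' f \<phi> v w} = card (A - B)"
    unfolding dashed by (rule bij_betw_same_card)
  \<comment> \<open>Both differences arise from sets of equal size by removing the same
    intersection.\<close>
  also have "\<dots> = card (B - A)"
    using card_AB fin by (simp add: card_Diff_subset_Int Int_commute)
  finally show "card (arrows_from (associated_digraph G G' f \<phi>) Normal v) =
      card (arrows_from (associated_digraph G G' f \<phi>) Dashed v)"
    by (simp add: arrows_from_associated_digraph[OF v] normal card_image inj_on_def)
qed

end
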